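(* Let $q\in C[0,b]$ be complex valued, let $f$ be a solution of $f''=qf$ on $[0,b]$ with $f\neq0$ on $[0,b]$, $f(0)=1$, $h:=f'(0)$, and let $\mathbf{K}$ be the transmutation kernel associated with $q$ and $h$ on $R_1=\{(x,t):0\le|t|\le x\le b\}$. Let the complex numbers $a_0,\ldots,a_N$ and $b_1,\ldots,b_N$ be such that $$\left|\frac h2+\frac14\int_0^xq(s)\,ds-\sum_{n=0}^Na_n\mathbf{c}_n(x)\right|<\varepsilon_1\qquad\text{and}\qquad\left|\frac14\int_0^xq(s)\,ds-\sum_{n=1}^Nb_n\mathbf{s}_n(x)\right|<\varepsilon_2$$ for any $x\in[0,b]$. Then the kernel $\mathbf{K}(x,t)$ is approximated by the function $$K_N(x,t)=a_0u_0(x,t)+\sum_{n=1}^Na_nu_{2n-1}(x,t)+\sum_{n=1}^Nb_nu_{2n}(x,t)$$ in such a way that for any $(x,t)\in R_1$ $$\bigl|\mathbf{K}(x,t)-K_N(x,t)\bigr|\le C(\varepsilon_1+\varepsilon_2),\qquad C=3I_0\big(b\sqrt M\big),\quad M:=\max_{[0,b]}|q(x)|,$$ where $I_0$ is the modified Bessel function of the first kind.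
   Context: Kernel: $\mathbf{K}(x,t)=\mathbf{H}\big(\frac{x+t}{2},\frac{x-t}{2}\big)$ on $R_1$, where $\mathbf{H}(u,v)$, $u,v\ge0$, $u+v\le b$, is the unique solution of $\frac{\partial^2\mathbf{H}(u,v)}{\partial u\,\partial v}=q(u+v)\mathbf{H}(u,v)$, $\mathbf{H}(u,0)=\frac h2+\frac12\int_0^u q(s)\,ds$, $\mathbf{H}(0,v)=\frac h2$ (equivalently $\mathbf{H}(u,v)=\frac h2+\frac12\int_0^u q(s)\,ds+\int_0^u\int_0^v q(\alpha+\beta)\mathbf{H}(\alpha,\beta)\,d\beta\,d\alpha$). Functions $\varphi_k$ on $[0,b]$: $X^{(0)}\equiv\widetilde X^{(0)}\equiv1$, $X^{(n)}(x)=n\int_0^x X^{(n-1)}(s)\left(f^2(s)\right)^{(-1)^n}ds$, $\widetilde X^{(n)}(x)=n\int_0^x \widetilde X^{(n-1)}(s)\left(f^2(s)\right)^{(-1)^{n-1}}ds$ for $n\ge1$; $\varphi_k=fX^{(k)}$ for $k$ odd, $\varphi_k=f\widetilde X^{(k)}$ for $k$ even. Generalized wave polynomials: $u_0(x,t)=\varphi_0(x)$ and, for $m\ge1$, $u_{2m-1}(x,t)=\sum_{\text{even }k=0}^m\binom mk\varphi_{m-k}(x)t^k$, $u_{2m}(x,t)=\sum_{\text{odd }k=1}^m\binom mk\varphi_{m-k}(x)t^k$. Traces: $\mathbf{c}_0(x)=u_0(x,x)=f(x)$, $\mathbf{c}_m(x)=u_{2m-1}(x,x)$, $\mathbf{s}_m(x)=u_{2m}(x,x)$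 for $m\ge1$. *)

theory Defs
  imports "HOL-Analysis.Analysis"
begin

definition goursat_domain :: "real \<Rightarrow> (real \<times> real) set" where
  "goursat_domain b = {(u, v). 0 \<le> u \<and> 0 \<le> v \<and> u + v \<le> b}"

text \<open>
  Classical solutions, continuous on the closed triangle; \<open>Hv\<close> is the partial
  derivative of \<open>H\<close> in \<open>v\<close>, and its partial derivative in \<open>u\<close> is the mixed derivative.
  Derivatives are taken along the slices of the triangle, so they are one-sided at the boundary.
\<close>

definition goursat_solution ::
  "real \<Rightarrow> (real \<Rightarrow> complex) \<Rightarrow> complex \<Rightarrow> (real \<Rightarrow> real \<Rightarrow> complex) \<Rightarrow> bool" where
  "goursat_solution b q h H \<longleftrightarrow>
     continuous_on (goursat_domain b) (\<lambda>(u, v). H u v) \<and>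
     (\<exists>Hv. \<forall>(u, v) \<in> goursat_domain b.
        ((\<lambda>v'. H u v') has_vector_derivative Hv u v) (at v within {0..b - u}) \<and>
        ((\<lambda>u'. Hv u' v) has_vector_derivative q (u + v) * H u v) (at u within {0..b - v})) \<and>
     (\<forall>u \<in> {0..b}. H u 0 = h / 2 + 1 / 2 * integral {0..u} q) \<and>
     (\<forall>v \<in> {0..b}. H 0 v = h / 2)"

definition kernel_domain :: "real \<Rightarrow> (real \<times> real) set" where
  "kernel_domain b = {(x, t). 0 \<le> \<bar>t\<bar> \<and> \<bar>t\<bar> \<le> x \<and> x \<le> b}"

text \<open>
  The Goursat problem determines \<open>H\<close> on the triangle only, hence \<open>K\<close> is characterised by its
  values on \<open>kernel_domain b\<close>.
\<close>

definition transmutation_kernel ::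
  "real \<Rightarrow> (real \<Rightarrow> complex) \<Rightarrow> complex \<Rightarrow> (real \<Rightarrow> real \<Rightarrow> complex) \<Rightarrow> bool" where
  "transmutation_kernel b q h K \<longleftrightarrow>
     (\<exists>H. goursat_solution b q h H \<and>
          (\<forall>(x, t) \<in> kernel_domain b. K x t = H ((x + t) / 2) ((x - t) / 2)))"

primrec X :: "(real \<Rightarrow> complex) \<Rightarrow> nat \<Rightarrow> real \<Rightarrow> complex" where
  "X f 0 = (\<lambda>x. 1)"
| "X f (Suc n) = (\<lambda>x. of_nat (Suc n) *
     integral {0..x} (\<lambda>s. X f n s * ((f s)\<^sup>2) powi ((- 1) ^ Suc n)))"

primrec X_tilde :: "(real \<Rightarrow> complex) \<Rightarrow> nat \<Rightarrow> real \<Rightarrow> complex" where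
  "X_tilde f 0 = (\<lambda>x. 1)"
| "X_tilde f (Suc n) = (\<lambda>x. of_nat (Suc n) *
     integral {0..x} (\<lambda>s. X_tilde f n s * ((f s)\<^sup>2) powi ((- 1) ^ n)))"

definition formal_power :: "(real \<Rightarrow> complex) \<Rightarrow> nat \<Rightarrow> real \<Rightarrow> complex" where
  "formal_power f k x = f x * (if odd k then X f k x else X_tilde f k x)"

text \<open>
  The generalized wave polynomials \<open>u\<^sub>n\<close>. For \<open>m \<ge> 1\<close>, the index \<open>n = 2 * m - 1\<close> collects
  the even powers of \<open>t\<close> and \<open>n = 2 * m\<close> the odd ones.
\<close>

definition wave_poly :: "(real \<Rightarrow> complex) \<Rightarrow> nat \<Rightarrow> real \<Rightarrow> real \<Rightarrow> complex" where
  "wave_poly f n x t =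
     (if n = 0 then formal_power f 0 x
      else if odd n then
        (let m = (n + 1) div 2 in
          \<Sum>k \<in> {k. k \<le> m \<and> even k}.
            of_nat (m choose k) * formal_power f (m - k) x * of_real t ^ k)
      else
        (let m = n div 2 in
          \<Sum>k \<in> {k. k \<le> m \<and> odd k}.
            of_nat (m choose k) * formal_power f (m - k) x * of_real t ^ k))"

definition c_trace :: "(real \<Rightarrow> complex) \<Rightarrow> nat \<Rightarrow> real \<Rightarrow> complex" where
  "c_trace f m x = (if m = 0 then wave_poly f 0 x x else wave_poly f (2 * m - 1) x x)"

text \<open>Only used for \<open>m \<ge> 1\<close>.\<close>

definition s_trace :: "(real \<Rightarrow> complex) \<Rightarrow> nat \<Rightarrow> real \<Rightarrow> complex" where
  "s_trace f m x = wave_poly f (2 * m) x x"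

text \<open>The modified Bessel function of the first kind of order 0, by its power series.\<close>

definition bessel_I0 :: "real \<Rightarrow> real" where
  "bessel_I0 z = (\<Sum>k. (z / 2) ^ (2 * k) / (fact k)\<^sup>2)"

end

theory Submission
  imports Defs
begin

text \<open>
  In the characteristic coordinates \<open>u = (x + t) / 2\<close>, \<open>v = (x - t) / 2\<close> the kernel becomes the
  Goursat solution \<open>H\<close>. The generalized wave polynomials solve the same linear equation
  \<open>D\<^sub>u\<^sub>v = q (u + v) D\<close> (\<open>goursat_equation_wave_sum\<close>), because the formal powers satisfy
  \<open>\<phi>\<^sub>k'' = q \<phi>\<^sub>k + k (k - 1) \<phi>\<^bsub>k-2\<^esub>\<close> just as the ordinary powers do for \<open>q = 0\<close>.
  Hence the error \<open>D\<close>, the difference of \<open>H\<close> and the approximant, is governed by its values on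
  the two characteristics \<open>v = 0\<close> and \<open>u = 0\<close>, that is, on \<open>t = x\<close> and \<open>t = - x\<close>.

  Let \<open>E1\<close> and \<open>E2\<close> be the two functions that the hypotheses bound by \<open>\<epsilon>1\<close> and \<open>\<epsilon>2\<close>. One half of the
  wave polynomials is even in \<open>t\<close>, the other half odd, so \<open>D u 0 = E1 u + E2 u\<close> and
  \<open>D 0 v = E1 v - E2 v\<close>. Integrating the equation twice gives
  \<open>D u v = D u 0 + D 0 v - D 0 0\<close> plus the double integral of \<open>q D\<close>; the three boundary terms
  account for the factor 3. A Picard iteration of this identity (\<open>goursat_stability\<close>) then yields
  the majorant \<open>\<Sum>j. (M u v)\<^sup>j / (j!)\<^sup>2\<close>, which is at most \<open>I\<^sub>0 (b \<surd>M)\<close> because \<open>4 u v \<le> b\<^sup>2\<close>.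
\<close>

section \<open>The Goursat equation\<close>

text \<open>
  The differential equation of \<open>goursat_solution\<close> without its boundary data. Dropping the data makes
  the condition linear, so that it passes to the difference between the kernel and its approximant.
\<close>

definition goursat_equation :: "real \<Rightarrow> (real \<Rightarrow> complex) \<Rightarrow> (real \<Rightarrow> real \<Rightarrow> complex) \<Rightarrow> bool" where
  "goursat_equation b q H \<longleftrightarrow>
     continuous_on (goursat_domain b) (\<lambda>(u, v). H u v) \<and>
     (\<exists>Hv. \<forall>(u, v) \<in> goursat_domain b.
        ((\<lambda>v'. H u v') has_vector_derivative Hv u v) (at v within {0..b - u}) \<and>
        ((\<lambda>u'. Hv u' v) has_vector_derivative q (u + v) * H u v) (at u within {0..b - v}))"

lemma goursat_equationI:
  assumes "continuous_on (goursat_domain b) (\<lambda>(u, v). H u v)"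
    and "\<And>u v. (u, v) \<in> goursat_domain b \<Longrightarrow>
      ((\<lambda>v'. H u v') has_vector_derivative Hv u v) (at v within {0..b - u})"
    and "\<And>u v. (u, v) \<in> goursat_domain b \<Longrightarrow>
      ((\<lambda>u'. Hv u' v) has_vector_derivative q (u + v) * H u v) (at u within {0..b - v})"
  shows "goursat_equation b q H"
  unfolding goursat_equation_def using assms by (intro conjI exI[of _ Hv]) auto

lemma goursat_equationE:
  assumes "goursat_equation b q H"
  obtains Hv where "continuous_on (goursat_domain b) (\<lambda>(u, v). H u v)"
    and "\<And>u v. (u, v) \<in> goursat_domain b \<Longrightarrow>
      ((\<lambda>v'. H u v') has_vector_derivative Hv u v) (at v within {0..b - u})"
    and "\<And>u v. (u, v) \<in> goursat_domain b \<Longrightarrow>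
      ((\<lambda>u'. Hv u' v) has_vector_derivative q (u + v) * H u v) (at u within {0..b - v})"
  using assms unfolding goursat_equation_def by fastforce

lemma goursat_equation_diff:
  assumes "goursat_equation b q H" "goursat_equation b q G"
  shows "goursat_equation b q (\<lambda>u v. H u v - G u v)"
proof -
  obtain Hv where H: "continuous_on (goursat_domain b) (\<lambda>(u, v). H u v)"
    "\<And>u v. (u, v) \<in> goursat_domain b \<Longrightarrow>
      ((\<lambda>v'. H u v') has_vector_derivative Hv u v) (at v within {0..b - u})"
    "\<And>u v. (u, v) \<in> goursat_domain b \<Longrightarrow>
      ((\<lambda>u'. Hv u' v) has_vector_derivative q (u + v) * H u v) (at u within {0..b - v})"
    using assms(1) by (rule goursat_equationE) (rule that)
  obtain Gv where G: "continuous_on (goursat_domain b) (\<lambda>(u, v). G u v)"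
    "\<And>u v. (u, v) \<in> goursat_domain b \<Longrightarrow>
      ((\<lambda>v'. G u v') has_vector_derivative Gv u v) (at v within {0..b - u})"
    "\<And>u v. (u, v) \<in> goursat_domain b \<Longrightarrow>
      ((\<lambda>u'. Gv u' v) has_vector_derivative q (u + v) * G u v) (at u within {0..b - v})"
    using assms(2) by (rule goursat_equationE) (rule that)
  show ?thesis
  proof (rule goursat_equationI[where Hv = "\<lambda>u v. Hv u v - Gv u v"])
    show "continuous_on (goursat_domain b) (\<lambda>(u, v). H u v - G u v)"
      using continuous_on_diff[OF H(1) G(1)] by (simp add: case_prod_unfold)
    show "((\<lambda>v'. H u v' - G u v') has_vector_derivative Hv u v - Gv u v) (at v within {0..b - u})"
      if "(u, v) \<in> goursat_domain b" for u v
      using that by (intro derivative_intros H G)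
    show "((\<lambda>u'. Hv u' v - Gv u' v) has_vector_derivative q (u + v) * (H u v - G u v))
        (at u within {0..b - v})" if "(u, v) \<in> goursat_domain b" for u v
      unfolding right_diff_distrib using that by (intro derivative_intros H G)
  qed
qed

lemma goursat_equation_lincomb:
  assumes "\<And>n. n \<in> I \<Longrightarrow> goursat_equation b q (G n)"
  shows "goursat_equation b q (\<lambda>u v. \<Sum>n\<in>I. c n * G n u v)"
proof -
  have "\<forall>n\<in>I. \<exists>Gv. continuous_on (goursat_domain b) (\<lambda>(u, v). G n u v) \<and>
      (\<forall>u v. (u, v) \<in> goursat_domain b \<longrightarrow>
        ((\<lambda>v'. G n u v') has_vector_derivative Gv u v) (at v within {0..b - u}) \<and>
        ((\<lambda>u'. Gv u' v) has_vector_derivative q (u + v) * G n u v) (at u within {0..b - v}))"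
    (is "\<forall>n\<in>I. ?P n")
  proof
    fix n assume "n \<in> I"
    from assms[OF this] obtain Gv where "continuous_on (goursat_domain b) (\<lambda>(u, v). G n u v)"
      "\<And>u v. (u, v) \<in> goursat_domain b \<Longrightarrow>
        ((\<lambda>v'. G n u v') has_vector_derivative Gv u v) (at v within {0..b - u})"
      "\<And>u v. (u, v) \<in> goursat_domain b \<Longrightarrow>
        ((\<lambda>u'. Gv u' v) has_vector_derivative q (u + v) * G n u v) (at u within {0..b - v})"
      by (rule goursat_equationE) (rule that)
    then show "?P n" by (intro exI[of _ Gv]) blast
  qed
  from bchoice[OF this] obtain Gv where G: "\<And>n. n \<in> I \<Longrightarrow> continuous_on (goursat_domain b) (\<lambda>(u, v). G n u v)"
    "\<And>n u v. n \<in> I \<Longrightarrow> (u, v) \<in> goursat_domain b \<Longrightarrow>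
      ((\<lambda>v'. G n u v') has_vector_derivative Gv n u v) (at v within {0..b - u})"
    "\<And>n u v. n \<in> I \<Longrightarrow> (u, v) \<in> goursat_domain b \<Longrightarrow>
      ((\<lambda>u'. Gv n u' v) has_vector_derivative q (u + v) * G n u v) (at u within {0..b - v})"
    by blast
  show ?thesis
  proof (rule goursat_equationI[where Hv = "\<lambda>u v. \<Sum>n\<in>I. c n * Gv n u v"])
    show "continuous_on (goursat_domain b) (\<lambda>(u, v). \<Sum>n\<in>I. c n * G n u v)"
      unfolding case_prod_unfold
      by (intro continuous_intros G(1)[unfolded case_prod_unfold])
  next
    fix u v assume "(u, v) \<in> goursat_domain b"
    then show "((\<lambda>v'. \<Sum>n\<in>I. c n * G n u v') has_vector_derivative (\<Sum>n\<in>I. c n * Gv n u v))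
        (at v within {0..b - u})"
      by (intro derivative_intros G)
  next
    fix u v assume uv: "(u, v) \<in> goursat_domain b"
    have "((\<lambda>u'. \<Sum>n\<in>I. c n * Gv n u' v) has_vector_derivative
        (\<Sum>n\<in>I. c n * (q (u + v) * G n u v))) (at u within {0..b - v})"
      using uv by (intro derivative_intros G)
    then show "((\<lambda>u'. \<Sum>n\<in>I. c n * Gv n u' v) has_vector_derivative
        q (u + v) * (\<Sum>n\<in>I. c n * G n u v)) (at u within {0..b - v})"
      by (simp add: sum_distrib_left mult.left_commute)
  qed
qed

lemma goursat_equation_add:
  assumes "goursat_equation b q H" "goursat_equation b q G"
  shows "goursat_equation b q (\<lambda>u v. H u v + G u v)"
  using goursat_equation_lincomb[of UNIV b q "\<lambda>i. if i then H else G" "\<lambda>_. 1"] assms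
  by (simp add: UNIV_bool add.commute)

section \<open>Stability of the Goursat problem\<close>

lemma compact_goursat_domain: "compact (goursat_domain b)"
proof -
  have "goursat_domain b =
      ({0..b} \<times> {0..b}) \<inter> {p. 0 \<le> fst p} \<inter> {p. 0 \<le> snd p} \<inter> {p. fst p + snd p \<le> b}"
    by (auto simp: goursat_domain_def)
  moreover have "closed {p::real \<times> real. 0 \<le> fst p}" "closed {p::real \<times> real. 0 \<le> snd p}"
    "closed {p::real \<times> real. fst p + snd p \<le> b}"
    by (intro closed_Collect_le continuous_intros)+
  ultimately show ?thesis
    by (simp only:) (intro compact_Int_closed compact_Times compact_Icc)
qed

text \<open>
  The one-dimensional integration behind the Picard iteration. A mean value inequality suits it
  better than integrals: a Goursat solution is known through iterated slice derivatives, so that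
  a double integral of the mixed derivative would first need an argument for joint regularity of
  the inner derivative.
\<close>

lemma norm_increment_le_polynomial:
  fixes g :: "real \<Rightarrow> complex"
  assumes s: "0 \<le> s"
    and g: "\<And>x. x \<in> {0..s} \<Longrightarrow> (g has_vector_derivative g' x) (at x within {0..s})"
    and le: "\<And>x. x \<in> {0..s} \<Longrightarrow> cmod (g' x) \<le> (\<Sum>j\<in>J. C j * x ^ j)"
  shows "cmod (g s - g 0) \<le> (\<Sum>j\<in>J. C j * s ^ Suc j / real (Suc j))"
proof (cases "s = 0")
  case False
  let ?\<phi> = "\<lambda>x. \<Sum>j\<in>J. C j * x ^ Suc j / real (Suc j)"
  have d: "(?\<phi> has_vector_derivative (\<Sum>j\<in>J. C j * x ^ j)) (at x)" for x :: real
    unfolding has_real_derivative_iff_has_vector_derivative[symmetric]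
    by (auto intro!: derivative_eq_intros sum.cong simp del: power_Suc of_nat_Suc)
  have "cmod (g s - g 0) \<le> ?\<phi> s - ?\<phi> 0"
  proof (rule differentiable_bound_general[where f' = g'])
    show "0 < s" using s False by simp
    show "continuous_on {0..s} g"
      using g by (rule continuous_on_vector_derivative)
    show "continuous_on {0..s} ?\<phi>" by (intro continuous_intros) auto
    show "(g has_vector_derivative g' x) (at x)" if "0 < x" "x < s" for x
      using g[of x] that by (simp add: at_within_Icc_at)
  qed (use d le in auto)
  then show ?thesis by simp
qed simp

text \<open>
  One Picard step. A bound on \<open>D\<close> bounds \<open>q D\<close>, the \<open>u\<close>-derivative of \<open>Dv\<close>; integrating in \<open>u\<close> bounds
  \<open>Dv u y - Dv 0 y\<close>, which is the \<open>v\<close>-derivative of \<open>D u y - D 0 y\<close>; integrating in \<open>v\<close> bounds \<open>D\<close> up to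
  the boundary terms. Each integration raises one exponent by one and divides by it, which turns
  \<open>(M u v)\<^sup>j / (j!)\<^sup>2\<close> into its successor.
\<close>

lemma goursat_iteration_step:
  assumes Dv: "\<And>u v. (u, v) \<in> goursat_domain b \<Longrightarrow>
      ((\<lambda>v'. D u v') has_vector_derivative Dv u v) (at v within {0..b - u})"
    and Dvu: "\<And>u v. (u, v) \<in> goursat_domain b \<Longrightarrow>
      ((\<lambda>u'. Dv u' v) has_vector_derivative q (u + v) * D u v) (at u within {0..b - v})"
    and q: "\<And>x. x \<in> {0..b} \<Longrightarrow> cmod (q x) \<le> M"
    and boundary: "\<And>u v. (u, v) \<in> goursat_domain b \<Longrightarrow> cmod (D u 0 + D 0 v - D 0 0) \<le> A"
    and D: "\<And>u v. (u, v) \<in> goursat_domain b \<Longrightarrow>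
      cmod (D u v) \<le> (\<Sum>j\<in>J. c j * (M * u * v) ^ j / (fact j)\<^sup>2)"
    and uv: "(u, v) \<in> goursat_domain b"
  shows "cmod (D u v) \<le> A + (\<Sum>j\<in>J. c j * (M * u * v) ^ Suc j / (fact (Suc j))\<^sup>2)"
proof -
  have *: "cmod (Dv u y - Dv 0 y) \<le>
      (\<Sum>j\<in>J. (c j * M ^ Suc j * u ^ Suc j / ((fact j)\<^sup>2 * real (Suc j))) * y ^ j)"
    if y: "y \<in> {0..v}" for y
  proof -
    have "cmod (Dv u y - Dv 0 y) \<le>
        (\<Sum>j\<in>J. (c j * M ^ Suc j * y ^ j / (fact j)\<^sup>2) * u ^ Suc j / real (Suc j))"
    proof (rule norm_increment_le_polynomial[where g' = "\<lambda>x. q (x + y) * D x y"])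
      show "0 \<le> u" using uv by (auto simp: goursat_domain_def)
      fix x assume x: "x \<in> {0..u}"
      then have xy: "(x, y) \<in> goursat_domain b" using y uv by (auto simp: goursat_domain_def)
      show "((\<lambda>x. Dv x y) has_vector_derivative q (x + y) * D x y) (at x within {0..u})"
        by (rule has_vector_derivative_within_subset[OF Dvu[OF xy]])
          (use y uv in \<open>auto simp: goursat_domain_def\<close>)
      have "cmod (q (x + y) * D x y) \<le> M * (\<Sum>j\<in>J. c j * (M * x * y) ^ j / (fact j)\<^sup>2)"
        unfolding norm_mult using xy
        by (intro mult_mono q D order_trans[OF norm_ge_zero q])
           (auto simp: goursat_domain_def intro: order_trans[OF norm_ge_zero D])
      also have "\<dots> = (\<Sum>j\<in>J. (c j * M ^ Suc j * y ^ j / (fact j)\<^sup>2) * x ^ j)"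
        by (simp add: sum_distrib_left power_mult_distrib mult_ac)
      finally show "cmod (q (x + y) * D x y) \<le> \<dots>" .
    qed
    then show ?thesis by (simp add: mult_ac del: of_nat_Suc)
  qed
  have "cmod ((D u v - D 0 v) - (D u 0 - D 0 0)) \<le>
      (\<Sum>j\<in>J. (c j * M ^ Suc j * u ^ Suc j / ((fact j)\<^sup>2 * real (Suc j))) * v ^ Suc j / real (Suc j))"
  proof (rule norm_increment_le_polynomial[where g' = "\<lambda>y. Dv u y - Dv 0 y"])
    show "0 \<le> v" using uv by (auto simp: goursat_domain_def)
    fix y assume y: "y \<in> {0..v}"
    then have "(u, y) \<in> goursat_domain b" "(0, y) \<in> goursat_domain b"
      "{0..v} \<subseteq> {0..b - u}" "{0..v} \<subseteq> {0..b - 0}"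
      using uv by (auto simp: goursat_domain_def)
    then show "((\<lambda>y. D u y - D 0 y) has_vector_derivative Dv u y - Dv 0 y) (at y within {0..v})"
      by (intro derivative_intros has_vector_derivative_within_subset[OF Dv])
    show "cmod (Dv u y - Dv 0 y) \<le>
      (\<Sum>j\<in>J. (c j * M ^ Suc j * u ^ Suc j / ((fact j)\<^sup>2 * real (Suc j))) * y ^ j)"
      using y by (rule *)
  qed
  also have "\<dots> = (\<Sum>j\<in>J. c j * (M * u * v) ^ Suc j / (fact (Suc j))\<^sup>2)"
    by (intro sum.cong refl)
      (simp add: power_mult_distrib power2_eq_square mult_ac del: of_nat_Suc)
  finally have "cmod ((D u v - D 0 v) - (D u 0 - D 0 0)) \<le> \<dots>" .
  moreover have "D u v = (D u 0 + D 0 v - D 0 0) + ((D u v - D 0 v) - (D u 0 - D 0 0))"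
    by simp
  ultimately show ?thesis
    using norm_triangle_ineq[of "D u 0 + D 0 v - D 0 0" "(D u v - D 0 v) - (D u 0 - D 0 0)"]
      boundary[OF uv] by simp
qed

lemma summable_bessel:
  fixes x :: real
  assumes "0 \<le> x"
  shows "summable (\<lambda>j. x ^ j / (fact j)\<^sup>2)"
proof (rule summable_comparison_test')
  show "summable (\<lambda>j. inverse (fact j) * x ^ j)" by (rule summable_exp)
  fix j :: nat
  have "x ^ j \<le> x ^ j * fact j" using assms by (simp add: mult_left_le fact_ge_1 mult_le_cancel_left1)
  then show "norm (x ^ j / (fact j)\<^sup>2) \<le> inverse (fact j) * x ^ j"
    using assms by (simp add: field_simps power2_eq_square)
qed

text \<open>
  Start from the bound \<open>L\<close> that compactness provides and iterate. After \<open>k\<close> steps the coefficient \<open>L\<close> has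
  moved to the \<open>k\<close>-th term, which tends to 0, while all lower coefficients have become \<open>A\<close>.
\<close>

theorem goursat_stability:
  assumes D: "goursat_equation b q D"
    and q: "\<And>x. x \<in> {0..b} \<Longrightarrow> cmod (q x) \<le> M"
    and boundary: "\<And>u v. (u, v) \<in> goursat_domain b \<Longrightarrow> cmod (D u 0 + D 0 v - D 0 0) \<le> A"
    and uv: "(u, v) \<in> goursat_domain b"
  shows "cmod (D u v) \<le> A * bessel_I0 (b * sqrt M)"
proof -
  obtain Dv where cont: "continuous_on (goursat_domain b) (\<lambda>(u, v). D u v)"
    and Dv: "\<And>u v. (u, v) \<in> goursat_domain b \<Longrightarrow>
      ((\<lambda>v'. D u v') has_vector_derivative Dv u v) (at v within {0..b - u})"
    and Dvu: "\<And>u v. (u, v) \<in> goursat_domain b \<Longrightarrow>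
      ((\<lambda>u'. Dv u' v) has_vector_derivative q (u + v) * D u v) (at u within {0..b - v})"
    using D by (rule goursat_equationE) (rule that)
  have "bounded ((\<lambda>(u, v). D u v) ` goursat_domain b)"
    by (intro compact_imp_bounded compact_continuous_image cont compact_goursat_domain)
  then obtain L where L: "\<And>u v. (u, v) \<in> goursat_domain b \<Longrightarrow> cmod (D u v) \<le> L"
    unfolding bounded_iff by fastforce
  have u: "0 \<le> u" and v: "0 \<le> v" and uvb: "u + v \<le> b" and b: "0 \<le> b"
    using uv by (auto simp: goursat_domain_def)
  have M: "0 \<le> M" using q[of 0] b order_trans[OF norm_ge_zero] by fastforce
  have A: "0 \<le> A" using order_trans[OF norm_ge_zero boundary[OF uv]] .
  have iterate: "cmod (D u v) \<le>
      (\<Sum>j\<le>k. (if j < k then A else L) * (M * u * v) ^ j / (fact j)\<^sup>2)"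
    if "(u, v) \<in> goursat_domain b" for u v k
    using that
  proof (induction k arbitrary: u v)
    case 0
    then show ?case using L by simp
  next
    case (Suc k)
    show ?case
      using goursat_iteration_step[OF Dv Dvu q boundary Suc.IH Suc.prems]
      by (simp add: sum.atMost_Suc_shift del: power_Suc fact_Suc sum.atMost_Suc)
  qed
  define e where "e x j = x ^ j / (fact j)\<^sup>2" for x :: real and j :: nat
  have summable_e: "summable (e x)" if "0 \<le> x" for x
    unfolding e_def using that by (rule summable_bessel)
  have nonneg: "0 \<le> M * u * v" using M u v by simp
  have le: "cmod (D u v) \<le> A * (\<Sum>j. e (M * u * v) j) + L * e (M * u * v) k" for k
  proof -
    have "(\<Sum>j\<le>k. (if j < k then A else L) * (M * u * v) ^ j / (fact j)\<^sup>2)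
        = (\<Sum>j<k. (if j < k then A else L) * e (M * u * v) j) + L * e (M * u * v) k"
      by (simp add: lessThan_Suc_atMost[symmetric] e_def)
    also have "(\<Sum>j<k. (if j < k then A else L) * e (M * u * v) j) = A * (\<Sum>j<k. e (M * u * v) j)"
      unfolding sum_distrib_left by (intro sum.cong) auto
    also have "\<dots> \<le> A * (\<Sum>j. e (M * u * v) j)"
      by (intro mult_left_mono sum_le_suminf summable_e nonneg A) (use nonneg in \<open>auto simp: e_def\<close>)
    finally show ?thesis using iterate[OF uv, of k] by simp
  qed
  have "(\<lambda>k. A * (\<Sum>j. e (M * u * v) j) + L * e (M * u * v) k)
      \<longlonglongrightarrow> A * (\<Sum>j. e (M * u * v) j) + L * 0"
    by (intro tendsto_intros summable_LIMSEQ_zero summable_e nonneg)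
  then have "cmod (D u v) \<le> A * (\<Sum>j. e (M * u * v) j)"
    using LIMSEQ_le_const[of _ _ "cmod (D u v)"] le by fastforce
  also have "(\<Sum>j. e (M * u * v) j) \<le> (\<Sum>j. e (M * b\<^sup>2 / 4) j)"
  proof (rule suminf_le)
    have "4 * (u * v) \<le> (u + v)\<^sup>2"
      using zero_le_power2[of "u - v"] by (simp add: power2_eq_square algebra_simps)
    also have "\<dots> \<le> b\<^sup>2" using u v uvb by (intro power_mono) auto
    finally have "M * u * v \<le> M * b\<^sup>2 / 4" using M by (simp add: mult_left_mono mult.assoc)
    then show "e (M * u * v) j \<le> e (M * b\<^sup>2 / 4) j" for j
      unfolding e_def using nonneg by (intro divide_right_mono power_mono) auto
  qed (use nonneg M in \<open>auto intro!: summable_e\<close>)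
  also have "(\<Sum>j. e (M * b\<^sup>2 / 4) j) = bessel_I0 (b * sqrt M)"
  proof -
    have "(b * sqrt M / 2)\<^sup>2 = M * b\<^sup>2 / 4"
      using M by (simp add: power_divide power_mult_distrib)
    then show ?thesis by (simp only: bessel_I0_def e_def power_mult)
  qed
  finally show ?thesis using A by (simp add: mult_left_mono)
qed

section \<open>Formal powers\<close>

text \<open>
  The formal powers alternate between \<open>X\<close> and \<open>X_tilde\<close>. Regrouping the two families into the
  sequence that occurs in the formal powers and the complementary one removes the parity from the
  recursion: differentiating a member of one sequence leads to the preceding member of the other,
  with weight \<open>1 / f\<^sup>2\<close> from this sequence to \<open>dual_factor\<close> and \<open>f\<^sup>2\<close> back.
\<close>

definition main_factor :: "(real \<Rightarrow> complex) \<Rightarrow> nat \<Rightarrow> real \<Rightarrow> complex" where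
  "main_factor f k = (if odd k then X f k else X_tilde f k)"

definition dual_factor :: "(real \<Rightarrow> complex) \<Rightarrow> nat \<Rightarrow> real \<Rightarrow> complex" where
  "dual_factor f k = (if odd k then X_tilde f k else X f k)"

definition formal_power_deriv ::
  "(real \<Rightarrow> complex) \<Rightarrow> (real \<Rightarrow> complex) \<Rightarrow> nat \<Rightarrow> real \<Rightarrow> complex" where
  "formal_power_deriv f f' k x =
     f' x * main_factor f k x + of_nat k * dual_factor f (k - 1) x * inverse (f x)"

lemma formal_power_eq: "formal_power f k x = f x * main_factor f k x"
  by (simp add: formal_power_def main_factor_def)

lemma integral_multiple_has_vector_derivative:
  fixes g :: "real \<Rightarrow> complex"
  assumes "continuous_on {0..b} g" "x \<in> {0..b}"
  shows "((\<lambda>x. c * integral {0..x} g) has_vector_derivative c * g x) (at x within {0..b})"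
  using assms by (intro derivative_intros integral_has_vector_derivative)

context
  fixes b :: real and q f f' :: "real \<Rightarrow> complex"
  assumes f: "\<And>x. x \<in> {0..b} \<Longrightarrow> (f has_vector_derivative f' x) (at x within {0..b})"
    and f': "\<And>x. x \<in> {0..b} \<Longrightarrow> (f' has_vector_derivative q x * f x) (at x within {0..b})"
    and nonzero: "\<And>x. x \<in> {0..b} \<Longrightarrow> f x \<noteq> 0"
begin

lemma continuous_on_weight: "continuous_on {0..b} (\<lambda>x. ((f x)\<^sup>2) powi i)"
  using nonzero by (intro continuous_intros continuous_on_vector_derivative[OF f]) auto

lemma continuous_on_X: "continuous_on {0..b} (X f n)"
proof (induction n)
  case (Suc n)
  have "continuous_on {0..b} (\<lambda>s. X f n s * ((f s)\<^sup>2) powi ((- 1) ^ Suc n))"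
    by (intro continuous_on_mult Suc continuous_on_weight)
  from integral_multiple_has_vector_derivative[OF this] show ?case
    unfolding X.simps by (rule continuous_on_vector_derivative)
qed simp

lemma continuous_on_X_tilde: "continuous_on {0..b} (X_tilde f n)"
proof (induction n)
  case (Suc n)
  have "continuous_on {0..b} (\<lambda>s. X_tilde f n s * ((f s)\<^sup>2) powi ((- 1) ^ n))"
    by (intro continuous_on_mult Suc continuous_on_weight)
  from integral_multiple_has_vector_derivative[OF this] show ?case
    unfolding X_tilde.simps by (rule continuous_on_vector_derivative)
qed simp

lemma X_has_vector_derivative:
  assumes "x \<in> {0..b}"
  shows "(X f (Suc n) has_vector_derivative
    of_nat (Suc n) * (X f n x * ((f x)\<^sup>2) powi ((- 1) ^ Suc n))) (at x within {0..b})"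
  unfolding X.simps using assms
  by (intro integral_multiple_has_vector_derivative continuous_on_mult
      continuous_on_X continuous_on_weight)

lemma X_tilde_has_vector_derivative:
  assumes "x \<in> {0..b}"
  shows "(X_tilde f (Suc n) has_vector_derivative
    of_nat (Suc n) * (X_tilde f n x * ((f x)\<^sup>2) powi ((- 1) ^ n))) (at x within {0..b})"
  unfolding X_tilde.simps using assms
  by (intro integral_multiple_has_vector_derivative continuous_on_mult
      continuous_on_X_tilde continuous_on_weight)

lemma main_factor_has_vector_derivative:
  assumes "x \<in> {0..b}"
  shows "(main_factor f k has_vector_derivative
    of_nat k * dual_factor f (k - 1) x * inverse ((f x)\<^sup>2)) (at x within {0..b})"
proof (cases k)
  case 0
  then show ?thesis by (simp add: main_factor_def)
next
  case (Suc n)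
  then show ?thesis
    using X_has_vector_derivative[OF assms, of n] X_tilde_has_vector_derivative[OF assms, of n]
    by (cases "even n") (simp_all add: main_factor_def dual_factor_def mult.assoc
        power_int_minus del: of_nat_Suc X.simps X_tilde.simps)
qed

lemma dual_factor_has_vector_derivative:
  assumes "x \<in> {0..b}"
  shows "(dual_factor f k has_vector_derivative
    of_nat k * main_factor f (k - 1) x * (f x)\<^sup>2) (at x within {0..b})"
proof (cases k)
  case 0
  then show ?thesis by (simp add: dual_factor_def)
next
  case (Suc n)
  then show ?thesis
    using X_has_vector_derivative[OF assms, of n] X_tilde_has_vector_derivative[OF assms, of n]
    by (cases "even n") (simp_all add: main_factor_def dual_factor_def mult.assoc
        del: of_nat_Suc X.simps X_tilde.simps)
qed

lemma formal_power_has_vector_derivative: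
  assumes x: "x \<in> {0..b}"
  shows "(formal_power f k has_vector_derivative formal_power_deriv f f' k x) (at x within {0..b})"
proof -
  have "((\<lambda>x. f x * main_factor f k x) has_vector_derivative
      f x * (of_nat k * dual_factor f (k - 1) x * inverse ((f x)\<^sup>2)) + f' x * main_factor f k x)
      (at x within {0..b})"
    using x by (intro derivative_intros f main_factor_has_vector_derivative)
  also have "f x * (of_nat k * dual_factor f (k - 1) x * inverse ((f x)\<^sup>2)) + f' x * main_factor f k x
      = formal_power_deriv f f' k x"
    using nonzero[OF x] by (simp add: formal_power_deriv_def field_simps power2_eq_square)
  finally show ?thesis by (simp add: formal_power_eq[abs_def])
qed

text \<open>
  The recursion \<open>\<phi>\<^sub>k'' = q \<phi>\<^sub>k + k (k - 1) \<phi>\<^bsub>k-2\<^esub>\<close>: the two terms with \<open>dual_factor\<close> cancel, and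
  differentiating \<open>dual_factor\<close> itself restores \<open>main_factor\<close> two indices lower. The truncated
  subtraction for \<open>k < 2\<close> is harmless, as the coefficient vanishes there.
\<close>

lemma formal_power_deriv_has_vector_derivative:
  assumes x: "x \<in> {0..b}"
  shows "(formal_power_deriv f f' k has_vector_derivative
    q x * formal_power f k x + of_nat k * of_nat (k - 1) * formal_power f (k - 2) x)
    (at x within {0..b})"
proof -
  have inv: "((\<lambda>x. inverse (f x)) has_vector_derivative
      f' x * - (inverse (f x) ^ Suc (Suc 0))) (at x within {0..b})"
    using field_vector_diff_chain_within[OF f[OF x] DERIV_inverse[OF nonzero[OF x]]]
    by (simp add: o_def)
  have "((\<lambda>x. f' x * main_factor f k x + of_nat k * dual_factor f (k - 1) x * inverse (f x))
      has_vector_derivative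
      (f' x * (of_nat k * dual_factor f (k - 1) x * inverse ((f x)\<^sup>2)) +
        q x * f x * main_factor f k x) +
      (of_nat k * dual_factor f (k - 1) x * (f' x * - (inverse (f x) ^ Suc (Suc 0))) +
        of_nat k * (of_nat (k - 1) * main_factor f (k - 1 - 1) x * (f x)\<^sup>2) * inverse (f x)))
      (at x within {0..b})"
    using x
    by (intro derivative_intros f' inv main_factor_has_vector_derivative
        dual_factor_has_vector_derivative)
  also have "(f' x * (of_nat k * dual_factor f (k - 1) x * inverse ((f x)\<^sup>2)) +
        q x * f x * main_factor f k x) +
      (of_nat k * dual_factor f (k - 1) x * (f' x * - (inverse (f x) ^ Suc (Suc 0))) +
        of_nat k * (of_nat (k - 1) * main_factor f (k - 1 - 1) x * (f x)\<^sup>2) * inverse (f x))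
    = q x * formal_power f k x + of_nat k * of_nat (k - 1) * formal_power f (k - 2) x"
    using nonzero[OF x]
    by (simp add: formal_power_eq power2_eq_square numeral_2_eq_2)
  finally show ?thesis by (simp add: formal_power_deriv_def[abs_def])
qed

end

section \<open>Generalized wave polynomials\<close>

text \<open>
  Both kinds of wave polynomials at once: \<open>P\<close> selects the parity of the powers of \<open>t\<close>.
\<close>

definition wave_sum ::
  "(real \<Rightarrow> complex) \<Rightarrow> (nat \<Rightarrow> bool) \<Rightarrow> nat \<Rightarrow> real \<Rightarrow> real \<Rightarrow> complex" where
  "wave_sum f P m x t =
     (\<Sum>k \<in> {k. k \<le> m \<and> P k}. of_nat (m choose k) * formal_power f (m - k) x * of_real t ^ k)"

text \<open>
  Truncated subtraction lets this cover the exceptional index 0 as well, which is \<open>m = 0\<close>.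
\<close>

lemma wave_poly_odd_index: "wave_poly f (2 * m - 1) = wave_sum f even m"
proof (cases m)
  case 0
  have "{k. k \<le> 0 \<and> even k} = {0::nat}" by auto
  then show ?thesis using 0 by (simp add: fun_eq_iff wave_poly_def wave_sum_def)
next
  case (Suc n)
  then have "2 * m - 1 \<noteq> 0" "odd (2 * m - 1)" "(2 * m - 1 + 1) div 2 = m" by auto
  then show ?thesis by (simp only: fun_eq_iff wave_poly_def wave_sum_def Let_def if_True if_False)
      simp
qed

lemma wave_poly_even_index: "m \<ge> 1 \<Longrightarrow> wave_poly f (2 * m) = wave_sum f odd m"
  by (auto simp: fun_eq_iff wave_poly_def wave_sum_def)

lemma wave_sum_even_minus: "wave_sum f even m x (- t) = wave_sum f even m x t"
  unfolding wave_sum_def by (intro sum.cong) auto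

lemma wave_sum_odd_minus: "wave_sum f odd m x (- t) = - wave_sum f odd m x t"
  unfolding wave_sum_def sum_negf[symmetric] by (intro sum.cong) auto

lemma binomial_two_step:
  "(m choose Suc (Suc k)) * (Suc (Suc k) * Suc k) = (m choose k) * ((m - k) * (m - k - 1))"
proof -
  have step: "Suc i * (m choose Suc i) = (m - i) * (m choose i)" for i
    by (simp only: binomial_absorption binomial_absorb_comp)
  have "(m choose Suc (Suc k)) * (Suc (Suc k) * Suc k) = Suc k * (Suc (Suc k) * (m choose Suc (Suc k)))"
    by (simp only: mult_ac)
  also have "\<dots> = (m - Suc k) * (Suc k * (m choose Suc k))"
    by (simp only: step[of "Suc k"]) (simp only: mult_ac)
  also have "\<dots> = (m choose k) * ((m - k) * (m - k - 1))"
    by (simp only: step[of k]) (simp add: mult_ac)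
  finally show ?thesis .
qed

text \<open>
  The equality of the second \<open>x\<close>-derivative and the second \<open>t\<close>-derivative of the homogeneous
  polynomial \<open>\<Sum>k. (m choose k) \<phi>\<^bsub>m-k\<^esub> t\<^sup>k\<close>, up to the potential term. The shift by two respects the
  selected parity.
\<close>

lemma sum_shift_two:
  fixes \<phi> :: "nat \<Rightarrow> complex" and t :: complex
  assumes P: "\<And>k. P (Suc (Suc k)) = P k"
  shows "(\<Sum>k \<in> {k. k \<le> m \<and> P k}.
      of_nat (m choose k) * (of_nat (m - k) * of_nat (m - k - 1) * \<phi> (m - k - 2)) * t ^ k)
    = (\<Sum>k \<in> {k. k \<le> m \<and> P k}.
      of_nat (m choose k) * \<phi> (m - k) * (of_nat k * of_nat (k - 1) * t ^ (k - 2)))"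
    (is "sum ?g ?S = sum ?h ?S")
proof -
  have "sum ?g ?S = sum ?g {k. k + 2 \<le> m \<and> P k}"
    by (rule sum.mono_neutral_right) auto
  also have "\<dots> = sum ?h {k. 2 \<le> k \<and> k \<le> m \<and> P k}"
  proof (rule sum.reindex_bij_witness[where i = "\<lambda>k. k - 2" and j = "\<lambda>k. k + 2"])
    fix k assume k: "k \<in> {k. 2 \<le> k \<and> k \<le> m \<and> P k}"
    then have "k = Suc (Suc (k - 2))" by auto
    then show "k - 2 \<in> {k. k + 2 \<le> m \<and> P k}" using k P[of "k - 2"] by auto
  next
    fix k
    have idx: "k + 2 = Suc (Suc k)" "m - Suc (Suc k) = m - k - 2" "Suc (Suc k) - 1 = Suc k"
      "Suc (Suc k) - 2 = k"
      by auto
    show "?h (k + 2) = ?g k"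
      using arg_cong[OF binomial_two_step[of m k], of "\<lambda>i. of_nat i * (\<phi> (m - k - 2) * t ^ k)"]
      unfolding of_nat_mult idx by (simp only: mult_ac)
  qed (auto simp: P)
  also have "\<dots> = sum ?h ?S"
  proof (rule sum.mono_neutral_left)
    have "k = 0 \<or> k = 1" if "k \<in> ?S - {k. 2 \<le> k \<and> k \<le> m \<and> P k}" for k
      using that by auto
    then show "\<forall>k \<in> ?S - {k. 2 \<le> k \<and> k \<le> m \<and> P k}. ?h k = 0" by fastforce
  qed auto
  finally show ?thesis .
qed

lemma has_vector_derivative_translate:
  fixes g :: "real \<Rightarrow> complex"
  assumes "(g has_vector_derivative g') (at (u + v) within {0..b})" "0 \<le> u"
  shows "((\<lambda>y. g (u + y)) has_vector_derivative g') (at v within {0..b - u})"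
proof -
  have "((\<lambda>y. u + y) has_vector_derivative 1) (at v within {0..b - u})"
    by (auto intro!: derivative_eq_intros)
  moreover have "(g has_vector_derivative g') (at (u + v) within (\<lambda>y. u + y) ` {0..b - u})"
    using assms by (intro has_vector_derivative_within_subset[OF assms(1)]) auto
  ultimately show ?thesis
    using vector_diff_chain_within[of "\<lambda>y. u + y" 1 v "{0..b - u}" g g'] by (simp add: o_def)
qed

lemma has_vector_derivative_of_real_power:
  fixes p :: "real \<Rightarrow> real"
  assumes "(p has_real_derivative d) (at x within S)"
  shows "((\<lambda>y. of_real (p y) ^ k :: complex) has_vector_derivative
    of_real d * (of_nat k * of_real (p x) ^ (k - 1))) (at x within S)"
proof -
  have "((\<lambda>y. p y ^ k) has_real_derivative d * (real k * p x ^ (k - 1))) (at x within S)"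
    using assms by (auto intro!: derivative_eq_intros)
  then have "((\<lambda>y. of_real (p y ^ k) :: complex) has_vector_derivative
      of_real (d * (real k * p x ^ (k - 1)))) (at x within S)"
    by (intro has_vector_derivative_of_real)
      (simp add: has_real_derivative_iff_has_vector_derivative)
  then show ?thesis by simp
qed

text \<open>
  With \<open>x = u + v\<close> and \<open>t = u - v\<close> the operator \<open>\<partial>\<^sub>u \<partial>\<^sub>v\<close> is \<open>\<partial>\<^sub>x\<^sup>2 - \<partial>\<^sub>t\<^sup>2\<close>; the witness \<open>Hv\<close> is \<open>\<partial>\<^sub>x - \<partial>\<^sub>t\<close> applied to
  the sum. The second derivatives cancel by \<open>sum_shift_two\<close>, except for the term \<open>q \<phi>\<^sub>k\<close>.
\<close>

lemma goursat_equation_wave_sum: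
  assumes f: "\<And>x. x \<in> {0..b} \<Longrightarrow> (f has_vector_derivative f' x) (at x within {0..b})"
    and f': "\<And>x. x \<in> {0..b} \<Longrightarrow> (f' has_vector_derivative q x * f x) (at x within {0..b})"
    and nonzero: "\<And>x. x \<in> {0..b} \<Longrightarrow> f x \<noteq> 0"
    and P: "\<And>k. P (Suc (Suc k)) = P k"
  shows "goursat_equation b q (\<lambda>u v. wave_sum f P m (u + v) (u - v))"
proof -
  let ?\<phi> = "formal_power f" and ?\<psi> = "formal_power_deriv f f'"
  let ?S = "{k. k \<le> m \<and> P k}" and ?C = "\<lambda>k. of_nat (m choose k) :: complex"
  let ?t = "\<lambda>u v. of_real (u - v) :: complex"
  note \<phi> = formal_power_has_vector_derivative[OF f f' nonzero]
  note \<psi> = formal_power_deriv_has_vector_derivative[OF f f' nonzero]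
  show ?thesis
    unfolding wave_sum_def
  proof (rule goursat_equationI[where Hv = "\<lambda>u v. \<Sum>k\<in>?S. ?C k *
        (?\<psi> (m - k) (u + v) * ?t u v ^ k - ?\<phi> (m - k) (u + v) * (of_nat k * ?t u v ^ (k - 1)))"])
    have "continuous_on (goursat_domain b) (\<lambda>p. ?\<phi> k (fst p + snd p))" for k
      by (rule continuous_on_compose2[OF continuous_on_vector_derivative[OF \<phi>]])
        (auto simp: goursat_domain_def intro!: continuous_intros)
    then show "continuous_on (goursat_domain b)
        (\<lambda>(u, v). \<Sum>k\<in>?S. ?C k * ?\<phi> (m - k) (u + v) * ?t u v ^ k)"
      unfolding case_prod_unfold by (intro continuous_intros)
  next
    fix u v assume uv: "(u, v) \<in> goursat_domain b"
    then have x: "u + v \<in> {0..b}" and u: "0 \<le> u" by (auto simp: goursat_domain_def)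
    have "((\<lambda>y. \<Sum>k\<in>?S. ?C k * (?\<phi> (m - k) (u + y) * ?t u y ^ k)) has_vector_derivative
        (\<Sum>k\<in>?S. ?C k * (?\<phi> (m - k) (u + v) * (of_real (- 1) * (of_nat k * ?t u v ^ (k - 1))) +
          ?\<psi> (m - k) (u + v) * ?t u v ^ k))) (at v within {0..b - u})"
      by (intro derivative_intros has_vector_derivative_translate \<phi> x u
          has_vector_derivative_of_real_power) (auto intro!: derivative_eq_intros)
    then show "((\<lambda>y. \<Sum>k\<in>?S. ?C k * ?\<phi> (m - k) (u + y) * ?t u y ^ k) has_vector_derivative
        (\<Sum>k\<in>?S. ?C k * (?\<psi> (m - k) (u + v) * ?t u v ^ k -
          ?\<phi> (m - k) (u + v) * (of_nat k * ?t u v ^ (k - 1))))) (at v within {0..b - u})"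
      by (simp add: mult.assoc)
  next
    fix u v assume uv: "(u, v) \<in> goursat_domain b"
    then have x: "v + u \<in> {0..b}" and v: "0 \<le> v" by (auto simp: goursat_domain_def)
    let ?x = "v + u"
    have "((\<lambda>y. \<Sum>k\<in>?S. ?C k * (?\<psi> (m - k) (v + y) * ?t y v ^ k -
          ?\<phi> (m - k) (v + y) * (of_nat k * ?t y v ^ (k - 1)))) has_vector_derivative
        (\<Sum>k\<in>?S. ?C k * (
          (?\<psi> (m - k) ?x * (of_real 1 * (of_nat k * ?t u v ^ (k - 1))) +
           (q ?x * ?\<phi> (m - k) ?x +
             of_nat (m - k) * of_nat (m - k - 1) * ?\<phi> (m - k - 2) ?x) * ?t u v ^ k) -
          (?\<phi> (m - k) ?x * (of_nat k * (of_real 1 * (of_nat (k - 1) * ?t u v ^ (k - 1 - 1)))) +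
           ?\<psi> (m - k) ?x * (of_nat k * ?t u v ^ (k - 1)))))) (at u within {0..b - v})"
      by (intro derivative_intros has_vector_derivative_translate \<phi> \<psi> x v
          has_vector_derivative_of_real_power) (auto intro!: derivative_eq_intros)
    also have "(\<Sum>k\<in>?S. ?C k * (
          (?\<psi> (m - k) ?x * (of_real 1 * (of_nat k * ?t u v ^ (k - 1))) +
           (q ?x * ?\<phi> (m - k) ?x +
             of_nat (m - k) * of_nat (m - k - 1) * ?\<phi> (m - k - 2) ?x) * ?t u v ^ k) -
          (?\<phi> (m - k) ?x * (of_nat k * (of_real 1 * (of_nat (k - 1) * ?t u v ^ (k - 1 - 1)))) +
           ?\<psi> (m - k) ?x * (of_nat k * ?t u v ^ (k - 1)))))
      = (\<Sum>k\<in>?S. q ?x * (?C k * ?\<phi> (m - k) ?x * ?t u v ^ k)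
          + ?C k * (of_nat (m - k) * of_nat (m - k - 1) * ?\<phi> (m - k - 2) ?x) * ?t u v ^ k
          - ?C k * ?\<phi> (m - k) ?x * (of_nat k * of_nat (k - 1) * ?t u v ^ (k - 2)))"
      by (intro sum.cong refl) (simp add: algebra_simps numeral_2_eq_2)
    also have "\<dots> = q ?x * (\<Sum>k\<in>?S. ?C k * ?\<phi> (m - k) ?x * ?t u v ^ k)"
      unfolding sum_subtractf sum.distrib sum_shift_two[of P m "\<lambda>i. ?\<phi> i ?x", OF P]
      by (simp add: sum_distrib_left)
    finally show "((\<lambda>y. \<Sum>k\<in>?S. ?C k * (?\<psi> (m - k) (y + v) * ?t y v ^ k -
          ?\<phi> (m - k) (y + v) * (of_nat k * ?t y v ^ (k - 1)))) has_vector_derivative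
        q (u + v) * (\<Sum>k\<in>?S. ?C k * ?\<phi> (m - k) (u + v) * ?t u v ^ k)) (at u within {0..b - v})"
      by (simp only: add.commute[of v])
  qed
qed

section \<open>Approximation of the transmutation kernel\<close>

theorem theorem8p1:
  fixes b \<epsilon>1 \<epsilon>2 M :: real
    and q f f' :: "real \<Rightarrow> complex"
    and h :: complex
    and K :: "real \<Rightarrow> real \<Rightarrow> complex"
    and N :: nat
    and \<alpha> \<beta> :: "nat \<Rightarrow> complex"
  assumes "b > 0"
    and "continuous_on {0..b} q"
    and "\<And>x. x \<in> {0..b} \<Longrightarrow> (f has_vector_derivative f' x) (at x within {0..b})"
    and "\<And>x. x \<in> {0..b} \<Longrightarrow> (f' has_vector_derivative q x * f x) (at x within {0..b})"
    and "\<And>x. x \<in> {0..b} \<Longrightarrow> f x \<noteq> 0"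
    and "f 0 = 1"
    and "h = f' 0"
    and "transmutation_kernel b q h K"
    and "M = (SUP x\<in>{0..b}. cmod (q x))"
    and "\<And>x. x \<in> {0..b} \<Longrightarrow>
           cmod (h / 2 + 1 / 4 * integral {0..x} q - (\<Sum>n=0..N. \<alpha> n * c_trace f n x)) < \<epsilon>1"
    and "\<And>x. x \<in> {0..b} \<Longrightarrow>
           cmod (1 / 4 * integral {0..x} q - (\<Sum>n=1..N. \<beta> n * s_trace f n x)) < \<epsilon>2"
  shows "\<forall>(x, t) \<in> kernel_domain b.
           cmod (K x t -
                 (\<alpha> 0 * wave_poly f 0 x t
                  + (\<Sum>n=1..N. \<alpha> n * wave_poly f (2 * n - 1) x t)
                  + (\<Sum>n=1..N. \<beta> n * wave_poly f (2 * n) x t)))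
           \<le> 3 * bessel_I0 (b * sqrt M) * (\<epsilon>1 + \<epsilon>2)"
proof -
  obtain H where H: "goursat_solution b q h H"
    and K: "\<And>x t. (x, t) \<in> kernel_domain b \<Longrightarrow> K x t = H ((x + t) / 2) ((x - t) / 2)"
    using assms(8) unfolding transmutation_kernel_def by blast
  define E1 where "E1 x = h / 2 + 1 / 4 * integral {0..x} q - (\<Sum>n=0..N. \<alpha> n * c_trace f n x)" for x
  define E2 where "E2 x = 1 / 4 * integral {0..x} q - (\<Sum>n=1..N. \<beta> n * s_trace f n x)" for x
  define W where "W x t = (\<Sum>n=0..N. \<alpha> n * wave_sum f even n x t)
      + (\<Sum>n=1..N. \<beta> n * wave_sum f odd n x t)" for x t
  define D where "D u v = H u v - W (u + v) (u - v)" for u v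
  have W_eq: "\<alpha> 0 * wave_poly f 0 x t + (\<Sum>n=1..N. \<alpha> n * wave_poly f (2 * n - 1) x t)
      + (\<Sum>n=1..N. \<beta> n * wave_poly f (2 * n) x t) = W x t" for x t
    using wave_poly_odd_index[of f 0]
    by (simp add: W_def sum.atLeast_Suc_atMost[of 0 N] wave_poly_odd_index[unfolded One_nat_def]
        wave_poly_even_index)
  have c: "c_trace f n x = wave_sum f even n x x" for n x
    using wave_poly_odd_index[of f n] by (cases "n = 0") (simp_all add: c_trace_def)
  have s: "s_trace f n x = wave_sum f odd n x x" if "n \<ge> 1" for n x
    using that by (simp add: s_trace_def wave_poly_even_index)
  have E1: "cmod (E1 x) \<le> \<epsilon>1" and E2: "cmod (E2 x) \<le> \<epsilon>2" if "x \<in> {0..b}" for x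
    using assms(10,11)[OF that] by (auto simp: E1_def E2_def)
  have D_u: "D u 0 = E1 u + E2 u" if "u \<in> {0..b}" for u
  proof -
    have "H u 0 = h / 2 + 1 / 2 * integral {0..u} q"
      using H that unfolding goursat_solution_def by blast
    then show ?thesis by (simp add: D_def W_def E1_def E2_def c s)
  qed
  have D_v: "D 0 v = E1 v - E2 v" if "v \<in> {0..b}" for v
  proof -
    have "H 0 v = h / 2"
      using H that unfolding goursat_solution_def by blast
    then show ?thesis
      by (simp add: D_def W_def E1_def E2_def c s wave_sum_even_minus wave_sum_odd_minus sum_negf)
  qed
  have equation: "goursat_equation b q D"
  proof -
    have "goursat_equation b q H"
      using H unfolding goursat_solution_def goursat_equation_def by blast
    moreover have "goursat_equation b q (\<lambda>u v. W (u + v) (u - v))"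
      unfolding W_def
      by (intro goursat_equation_add goursat_equation_lincomb
          goursat_equation_wave_sum[where f' = f'] assms(3-5)) auto
    ultimately show ?thesis
      unfolding D_def by (rule goursat_equation_diff)
  qed
  have q: "cmod (q x) \<le> M" if "x \<in> {0..b}" for x
  proof -
    have "compact ((\<lambda>x. cmod (q x)) ` {0..b})"
      by (intro compact_continuous_image continuous_intros assms(2)) auto
    then show ?thesis
      unfolding assms(9) using that
      by (intro cSUP_upper bounded_imp_bdd_above compact_imp_bounded)
  qed
  have boundary: "cmod (D u 0 + D 0 v - D 0 0) \<le> 3 * (\<epsilon>1 + \<epsilon>2)"
    if "(u, v) \<in> goursat_domain b" for u v
  proof -
    have u: "u \<in> {0..b}" and v: "v \<in> {0..b}" and 0: "0 \<in> {0..b}"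
      using that by (auto simp: goursat_domain_def)
    have "cmod (D u 0) \<le> \<epsilon>1 + \<epsilon>2"
      unfolding D_u[OF u] by (rule norm_triangle_mono[OF E1[OF u] E2[OF u]])
    moreover have "cmod (D 0 v) \<le> \<epsilon>1 + \<epsilon>2"
      unfolding D_v[OF v] using norm_triangle_ineq4[of "E1 v" "E2 v"] E1[OF v] E2[OF v] by simp
    moreover have "cmod (D 0 0) \<le> \<epsilon>1 + \<epsilon>2"
      unfolding D_u[OF 0] by (rule norm_triangle_mono[OF E1[OF 0] E2[OF 0]])
    ultimately show ?thesis
      using norm_triangle_ineq4[of "D u 0 + D 0 v" "D 0 0"] norm_triangle_ineq[of "D u 0" "D 0 v"]
      by simp
  qed
  have "cmod (K x t - W x t) \<le> 3 * bessel_I0 (b * sqrt M) * (\<epsilon>1 + \<epsilon>2)"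
    if "(x, t) \<in> kernel_domain b" for x t
  proof -
    have "((x + t) / 2, (x - t) / 2) \<in> goursat_domain b"
      using that by (auto simp: kernel_domain_def goursat_domain_def field_simps)
    from goursat_stability[OF equation q boundary this]
    have "cmod (D ((x + t) / 2) ((x - t) / 2)) \<le> 3 * (\<epsilon>1 + \<epsilon>2) * bessel_I0 (b * sqrt M)" .
    moreover have "D ((x + t) / 2) ((x - t) / 2) = K x t - W x t"
    proof -
      have "(x + t) / 2 + (x - t) / 2 = x" "(x + t) / 2 - (x - t) / 2 = t"
        by (simp_all add: field_simps)
      then show ?thesis by (simp only: D_def K[OF that])
    qed
    ultimately have "cmod (K x t - W x t) \<le> 3 * (\<epsilon>1 + \<epsilon>2) * bessel_I0 (b * sqrt M)"
      by (simp only:)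
    then show ?thesis by (simp only: mult_ac)
  qed
  then show ?thesis unfolding W_eq by blast
qed

end
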